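(* For every integer $d\ge 3$, there exist infinitely many triangulations $K$ of the $d$-simplex $\Delta^d$ such that there exists a facet $\sigma\in K$ with the property that every Sperner labelling of $K$ has a rainbow facet distinct from $\sigma$.
   Context: A triangulation of the $d$-simplex $\Delta^d$ (with vertices $v_1,\dots,v_{d+1}$) is a finite geometric simplicial complex $K$ whose union of simplices is $\Delta^d$ (a subdivision of $\Delta^d$); the vertices $v_1,\dots,v_{d+1}$ are vertices of $K$. The facets of $K$ are its $d$-dimensional simplices. A Sperner labelling of $K$ is a map $\lambda: V(K)\to\{1,\dots,d+1\}$ such that $\lambda(v_i)=i$ for each $i$, and every vertex of $K$ lying in a face of $\Delta^d$ has the same label as one of the vertices of that face. A simplex is rainbow if its vertices receive pairwise distinct labels. *)

theory Defs
  imports "HOL-Analysis.Analysis"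
begin

text \<open>
  Geometric simplicial complexes are those of the library (\<^const>\<open>simplicial_complex\<close>): finite
  sets of simplices, closed under taking faces, any two of them meeting in a common face. The
  empty simplex is a member of every nonempty complex. The ambient \<open>d\<close>-simplex is the convex hull
  of \<open>d + 1\<close> affinely independent points \<open>v 1, \<dots>, v (d + 1)\<close>.
\<close>

definition ambient_simplex :: "nat \<Rightarrow> (nat \<Rightarrow> 'a::euclidean_space) \<Rightarrow> 'a set" where
  "ambient_simplex d v = convex hull (v ` {1..d + 1})"

definition vertices :: "'a::euclidean_space set \<Rightarrow> 'a set" where
  "vertices S = {x. x extreme_point_of S}"

definition complex_vertices :: "'a::euclidean_space set set \<Rightarrow> 'a set" where
  "complex_vertices K = {x. {x} \<in> K}"

text \<open>The library's \<^const>\<open>triangulation\<close> does not require closure under faces, so it is not used.\<close>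

definition simplex_triangulation ::
    "nat \<Rightarrow> (nat \<Rightarrow> 'a::euclidean_space) \<Rightarrow> 'a set set \<Rightarrow> bool" where
  "simplex_triangulation d v K \<longleftrightarrow>
     simplicial_complex K \<and> \<Union>K = ambient_simplex d v \<and>
     v ` {1..d + 1} \<subseteq> complex_vertices K"

text \<open>Facets of a complex are its \<open>d\<close>-dimensional simplices, unlike the library's
  \<^const>\<open>facet_of\<close>, which denotes faces of codimension one.\<close>

definition complex_facets :: "nat \<Rightarrow> 'a::euclidean_space set set \<Rightarrow> 'a set set" where
  "complex_facets d K = {S \<in> K. int d simplex S}"

text \<open>A labelling is a total function; only its values on the vertices of \<open>K\<close> matter.\<close>

definition sperner_labelling ::
    "nat \<Rightarrow> (nat \<Rightarrow> 'a::euclidean_space) \<Rightarrow> 'a set set \<Rightarrow> ('a \<Rightarrow> nat) \<Rightarrow> bool" where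
  "sperner_labelling d v K l \<longleftrightarrow>
     l ` complex_vertices K \<subseteq> {1..d + 1} \<and>
     (\<forall>i\<in>{1..d + 1}. l (v i) = i) \<and>
     (\<forall>F. F face_of ambient_simplex d v \<longrightarrow>
        (\<forall>x\<in>complex_vertices K \<inter> F. \<exists>w\<in>vertices F. l x = l w))"

definition rainbow :: "('a::euclidean_space \<Rightarrow> nat) \<Rightarrow> 'a set \<Rightarrow> bool" where
  "rainbow l S \<longleftrightarrow> inj_on l (vertices S)"

text \<open>Isomorphism of the underlying abstract simplicial complexes. It is used to count
  triangulations by combinatorial type, so that merely moving vertices of one triangulation
  does not produce new ones.\<close>

definition combinatorially_isomorphic ::
    "'a::euclidean_space set set \<Rightarrow> 'a set set \<Rightarrow> bool" where
  "combinatorially_isomorphic K L \<longleftrightarrow>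
     (\<exists>f. bij_betw f (complex_vertices K) (complex_vertices L) \<and>
          (\<lambda>S. f ` vertices S) ` K = vertices ` L)"

end

theory Submission
  imports Defs
begin

text \<open>
  A regular triangulation is certified by heights on the vertices together with one affine
  functional per facet: on a common point of two facets the functionals agree, which gives the
  intersection property, and a point whose smallest functional belongs to the facet \<open>S\<close> lies in
  \<open>S\<close>, since crossing a wall of \<open>S\<close> would make the functional of the neighbour smaller.

  For \<open>d = 3\<close> there is a regular triangulation with five vertices besides \<open>v 1, \<dots>, v 4\<close> (two of
  them on the edge \<open>v 2 v 3\<close>, one on \<open>v 1 v 4\<close>, one on the triangle \<open>v 1 v 3 v 4\<close> and one in the interior)
  in which each of the 96 Sperner labellings has a rainbow facet other than a fixed \<open>\<sigma>\<close>. Joining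
  it with \<open>v 5, \<dots>, v (d + 1)\<close> gives an example in dimension \<open>d\<close>. Subdividing a facet
  \<open>\<tau> \<noteq> \<sigma>\<close> at its barycentre keeps the property, because if \<open>\<tau>\<close> is rainbow then replacing the vertex
  of \<open>\<tau>\<close> that has the label of the barycentre again gives a rainbow facet. Iterating yields
  examples with any larger number of vertices.
\<close>

subsection \<open>Affine functionals\<close>

definition affine_fun :: "('a::real_vector \<Rightarrow> real) \<Rightarrow> bool" where
  "affine_fun f \<longleftrightarrow> (\<exists>L c. linear L \<and> f = (\<lambda>x. L x + c))"

lemma affine_fun_diff:
  assumes "affine_fun f" "affine_fun g"
  shows "affine_fun (\<lambda>x. f x - g x)"
proof -
  obtain L c M e where "linear L" "linear M" "f = (\<lambda>x. L x + c)" "g = (\<lambda>x. M x + e)"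
    using assms unfolding affine_fun_def by auto
  then show ?thesis
    unfolding affine_fun_def
    by (intro exI[of _ "\<lambda>x. L x - M x"] exI[of _ "c - e"]) (auto intro: linear_compose_sub)
qed

lemma affine_fun_scale:
  assumes "affine_fun f"
  shows "affine_fun (\<lambda>x. k * f x)"
proof -
  obtain L c where "linear L" "f = (\<lambda>x. L x + c)"
    using assms unfolding affine_fun_def by auto
  then show ?thesis
    unfolding affine_fun_def
    by (intro exI[of _ "\<lambda>x. k * L x"] exI[of _ "k * c"])
      (auto simp: algebra_simps linear_iff)
qed

lemma affine_fun_uminus: "affine_fun f \<Longrightarrow> affine_fun (\<lambda>x. - f x)"
  using affine_fun_scale[of f "-1"] by simp

lemma affine_fun_add:
  assumes "affine_fun f" "affine_fun g"
  shows "affine_fun (\<lambda>x. f x + g x)"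
  using affine_fun_diff[OF assms(1) affine_fun_uminus[OF assms(2)]] by simp

lemma affine_fun_const: "affine_fun (\<lambda>x. k)"
  unfolding affine_fun_def by (intro exI[of _ "\<lambda>x. 0"] exI[of _ k]) (auto simp: linear_iff)

lemma affine_fun_sum: "(\<And>i. i \<in> I \<Longrightarrow> affine_fun (f i)) \<Longrightarrow> affine_fun (\<lambda>x. \<Sum>i\<in>I. f i x)"
  by (induction I rule: infinite_finite_induct) (auto intro: affine_fun_add affine_fun_const)

text \<open>The sum \<open>s\<close> is left free because two cases occur: affine combinations
  (\<open>s = 1\<close>) and affine dependences (\<open>s = 0\<close>).\<close>

lemma affine_fun_sum_weighted:
  fixes f :: "'a::real_vector \<Rightarrow> real"
  assumes "affine_fun f" and s: "sum u I = s"
  shows "f (\<Sum>i\<in>I. u i *\<^sub>R p i) = (\<Sum>i\<in>I. u i * f (p i)) + (1 - s) * f 0"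
proof -
  obtain L c where L: "linear L" and f: "f = (\<lambda>x. L x + c)"
    using assms unfolding affine_fun_def by auto
  have "f (\<Sum>i\<in>I. u i *\<^sub>R p i) = (\<Sum>i\<in>I. u i * L (p i)) + c"
    by (simp add: f linear_sum[OF L] linear_scale[OF L])
  moreover have "(\<Sum>i\<in>I. u i * f (p i)) = (\<Sum>i\<in>I. u i * L (p i)) + s * c"
    by (simp add: f distrib_left sum.distrib sum_distrib_right flip: s)
  ultimately show ?thesis
    by (simp add: f linear_0[OF L] algebra_simps)
qed

lemma affine_fun_combination:
  assumes "affine_fun f" "sum u I = 1"
  shows "f (\<Sum>i\<in>I. u i *\<^sub>R p i) = (\<Sum>i\<in>I. u i * f (p i))"
  using affine_fun_sum_weighted[OF assms] by simp

text \<open>Translating by a point \<open>a\<close> of \<open>V\<close> turns the other points into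
  a linearly independent set, on which a linear map can be prescribed; the constant term then
  corrects the value at \<open>a\<close>.\<close>

lemma affine_fun_extend:
  fixes V :: "'a::euclidean_space set"
  assumes "\<not> affine_dependent V"
  obtains f where "affine_fun f" "\<And>v. v \<in> V \<Longrightarrow> f v = c v"
proof (cases "V = {}")
  case True
  then show ?thesis
    using affine_fun_const that by blast
next
  case False
  then obtain a where a: "a \<in> V"
    by blast
  have "independent ((\<lambda>x. - a + x) ` (V - {a}))"
    using assms affine_dependent_iff_dependent2[OF a] by simp
  from linear_independent_extend[OF this, of "\<lambda>y. c (a + y) - c a"]
  obtain L where L: "linear L" "\<And>y. y \<in> (\<lambda>x. - a + x) ` (V - {a}) \<Longrightarrow> L y = c (a + y) - c a"
    by blast
  show ?thesis
  proof
    show "affine_fun (\<lambda>x. L x + (c a - L a))"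
      unfolding affine_fun_def using L(1) by blast
    fix v assume "v \<in> V"
    show "L v + (c a - L a) = c v"
    proof (cases "v = a")
      case False
      then have "L (- a + v) = c v - c a"
        using L(2) \<open>v \<in> V\<close> by force
      then show ?thesis
        using linear_diff[OF L(1), of v a] by simp
    qed simp
  qed
qed

text \<open>Applying \<open>f\<close> to an affine dependence with a nonzero coefficient at
  \<open>s\<close> kills every term except the one at \<open>s\<close>.\<close>

lemma affine_independentI:
  fixes S :: "'a::euclidean_space set"
  assumes "finite S"
    and f: "\<And>s. s \<in> S \<Longrightarrow> \<exists>f. affine_fun f \<and> f s \<noteq> 0 \<and> (\<forall>t\<in>S - {s}. f t = 0)"
  shows "\<not> affine_dependent S"
proof
  assume "affine_dependent S"
  then obtain U s where U: "sum U S = 0" "s \<in> S" "U s \<noteq> 0" "(\<Sum>v\<in>S. U v *\<^sub>R v) = 0"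
    using affine_dependent_explicit_finite[OF \<open>finite S\<close>] by blast
  obtain f where f: "affine_fun f" "f s \<noteq> 0" "\<forall>t\<in>S - {s}. f t = 0"
    using f[OF \<open>s \<in> S\<close>] by blast
  have "(\<Sum>v\<in>S. U v * f v) = U s * f s + (\<Sum>v\<in>S - {s}. U v * f v)"
    using U \<open>finite S\<close> by (simp add: sum.remove)
  also have "(\<Sum>v\<in>S - {s}. U v * f v) = 0"
    by (rule sum.neutral) (use f in auto)
  finally show False
    using affine_fun_sum_weighted[OF f(1) U(1), of "\<lambda>x. x"] U f by simp
qed

lemma affine_fun_nonneg_convex_hull:
  fixes V :: "'a::euclidean_space set"
  assumes "finite V" "affine_fun f" "\<And>v. v \<in> V \<Longrightarrow> 0 \<le> f v" "x \<in> convex hull V"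
  shows "0 \<le> f x"
proof -
  obtain u where u: "\<forall>v\<in>V. 0 \<le> u v" "sum u V = 1" "(\<Sum>v\<in>V. u v *\<^sub>R v) = x"
    using assms(4) convex_hull_finite[OF assms(1)] by auto
  show ?thesis
    using affine_fun_combination[OF assms(2) u(2), of "\<lambda>x. x"] u assms(3)
    by (auto intro!: sum_nonneg)
qed

text \<open>Both sets have the same affine dimension, while a proper inclusion of affine hulls would
  raise it.\<close>

lemma affine_hull_eq_of_card_eq:
  fixes V :: "'a::euclidean_space set"
  assumes "\<not> affine_dependent S" "\<not> affine_dependent V" "card S = card V" "S \<subseteq> affine hull V"
  shows "affine hull S = affine hull V"
proof -
  have "aff_dim S = aff_dim V"
    using assms(3) aff_dim_affine_independent[OF assms(1)] aff_dim_affine_independent[OF assms(2)] by simp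
  moreover have "affine hull S \<subseteq> affine hull V"
    using assms(4) by (simp add: hull_minimal)
  ultimately show ?thesis
    using aff_dim_psubset[of S V] by (metis less_irrefl psubsetI)
qed

lemma vertices_convex_hull: "\<not> affine_dependent S \<Longrightarrow> vertices (convex hull S) = S"
  by (simp add: vertices_def extreme_point_of_convex_hull_affine_independent)

subsection \<open>Regular triangulations\<close>

text \<open>
  Certificate of a regular subdivision: \<open>h\<close> prescribes heights and the facets are the projected
  upper faces of the lifted point set. A wall of a facet is either carried by a supporting
  hyperplane of \<open>convex hull V\<close> or shared with another facet.
\<close>

definition regular_facets :: "'a::euclidean_space set \<Rightarrow> ('a \<Rightarrow> real) \<Rightarrow> 'a set set \<Rightarrow> bool" where
  "regular_facets V h \<Phi> \<longleftrightarrow>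
     finite \<Phi> \<and> \<Phi> \<noteq> {} \<and> V \<subseteq> \<Union>\<Phi> \<and> \<Union>\<Phi> \<subseteq> convex hull V \<and>
     (\<forall>S\<in>\<Phi>. card S = card V \<and>
        (\<exists>g. affine_fun g \<and> (\<forall>p\<in>S. g p = h p) \<and> (\<forall>p\<in>\<Union>\<Phi> - S. h p < g p)) \<and>
        (\<forall>s\<in>S. (\<exists>b. affine_fun b \<and> (\<forall>v\<in>V. 0 \<le> b v) \<and> 0 < b s \<and> (\<forall>p\<in>S - {s}. b p = 0)) \<or>
                (\<exists>T\<in>\<Phi>. T \<noteq> S \<and> S - {s} \<subseteq> T)))"

text \<open>\<open>F = {}\<close> is allowed, which puts the empty simplex into the complex, as
  closure under faces demands.\<close>

definition face_complex :: "'a::euclidean_space set set \<Rightarrow> 'a set set" where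
  "face_complex \<Phi> = {convex hull F | F S. S \<in> \<Phi> \<and> F \<subseteq> S}"

locale regular_subdivision =
  fixes V :: "'a::euclidean_space set" and h :: "'a \<Rightarrow> real" and \<Phi> :: "'a set set"
  assumes independent: "\<not> affine_dependent V" and nonempty: "V \<noteq> {}"
    and regular: "regular_facets V h \<Phi>"
begin

lemma finite_facets: "finite \<Phi>"
  and facets_nonempty: "\<Phi> \<noteq> {}"
  and V_subset: "V \<subseteq> \<Union>\<Phi>"
  and points_in_hull: "\<Union>\<Phi> \<subseteq> convex hull V"
  and card_facet: "S \<in> \<Phi> \<Longrightarrow> card S = card V"
  using regular unfolding regular_facets_def by auto

lemma finite_V: "finite V"
  using independent by (rule aff_independent_finite)

lemma finite_facet: "S \<in> \<Phi> \<Longrightarrow> finite S"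
  using card_facet[of S] finite_V nonempty by (metis card_0_eq card.infinite)

lemma finite_points: "finite (\<Union>\<Phi>)"
  using finite_facets finite_facet by auto

lemma facet_eq: "S \<in> \<Phi> \<Longrightarrow> T \<in> \<Phi> \<Longrightarrow> S \<subseteq> T \<Longrightarrow> S = T"
  by (simp add: card_facet card_subset_eq finite_facet)

text \<open>The functional supporting the lifted facet. For a facet \<open>S\<close> it is
  determined only on \<open>affine hull V\<close>, which may be smaller than the ambient space, so
  one is chosen.\<close>

definition roof :: "'a set \<Rightarrow> 'a \<Rightarrow> real" where
  "roof S = (SOME g. affine_fun g \<and> (\<forall>p\<in>S. g p = h p) \<and> (\<forall>p\<in>\<Union>\<Phi> - S. h p < g p))"

lemma roof:
  assumes "S \<in> \<Phi>"
  shows affine_roof: "affine_fun (roof S)"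
    and roof_eq: "p \<in> S \<Longrightarrow> roof S p = h p"
    and roof_gt: "p \<in> \<Union>\<Phi> \<Longrightarrow> p \<notin> S \<Longrightarrow> h p < roof S p"
proof -
  have "\<exists>g. affine_fun g \<and> (\<forall>p\<in>S. g p = h p) \<and> (\<forall>p\<in>\<Union>\<Phi> - S. h p < g p)"
    using regular assms unfolding regular_facets_def by blast
  from someI_ex[OF this] show "affine_fun (roof S)" "p \<in> S \<Longrightarrow> roof S p = h p"
    "p \<in> \<Union>\<Phi> \<Longrightarrow> p \<notin> S \<Longrightarrow> h p < roof S p"
    unfolding roof_def by blast+
qed

lemma roof_ge: "S \<in> \<Phi> \<Longrightarrow> p \<in> \<Union>\<Phi> \<Longrightarrow> h p \<le> roof S p"
  using roof_eq roof_gt by (metis less_eq_real_def)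

lemma wall_cases:
  assumes "S \<in> \<Phi>" "s \<in> S"
  obtains (boundary) b where "affine_fun b" "\<And>v. v \<in> V \<Longrightarrow> 0 \<le> b v" "0 < b s" "\<And>p. p \<in> S - {s} \<Longrightarrow> b p = 0"
  | (interior) T where "T \<in> \<Phi>" "T \<noteq> S" "S - {s} \<subseteq> T" "s \<notin> T"
proof -
  have "(\<exists>b. affine_fun b \<and> (\<forall>v\<in>V. 0 \<le> b v) \<and> 0 < b s \<and> (\<forall>p\<in>S - {s}. b p = 0)) \<or>
        (\<exists>T\<in>\<Phi>. T \<noteq> S \<and> S - {s} \<subseteq> T)"
    using regular assms unfolding regular_facets_def by blast
  then show ?thesis
  proof
    assume "\<exists>T\<in>\<Phi>. T \<noteq> S \<and> S - {s} \<subseteq> T"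
    then obtain T where T: "T \<in> \<Phi>" "T \<noteq> S" "S - {s} \<subseteq> T"
      by blast
    \<comment> \<open>If \<open>s\<close> were in \<open>T\<close>, then \<open>S\<close> would be
      contained in \<open>T\<close>, and equal cardinality would make them equal.\<close>
    then have "s \<notin> T"
      using facet_eq[OF assms(1) T(1)] by blast
    then show ?thesis
      using T interior by blast
  qed (use boundary in blast)
qed

text \<open>Treats both kinds of wall at once. No point of the hull lies across a boundary wall;
  across an interior wall the neighbour has the lower roof, the functional being the difference of
  the two roofs.\<close>

lemma wall_functional:
  assumes "S \<in> \<Phi>" "s \<in> S"
  obtains f where "affine_fun f" "0 < f s" "\<And>p. p \<in> S - {s} \<Longrightarrow> f p = 0"
    "\<And>x. x \<in> convex hull V \<Longrightarrow> f x < 0 \<Longrightarrow> \<exists>T\<in>\<Phi>. roof T x < roof S x"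
  using assms
proof (cases rule: wall_cases)
  case (boundary b)
  then have "0 \<le> b x" if "x \<in> convex hull V" for x
    using affine_fun_nonneg_convex_hull[OF finite_V] that by blast
  then show ?thesis
    using boundary that[of b] by fastforce
next
  case (interior T)
  show ?thesis
  proof (rule that[of "\<lambda>x. roof T x - roof S x"])
    show "affine_fun (\<lambda>x. roof T x - roof S x)"
      by (simp add: affine_fun_diff affine_roof assms interior)
    show "0 < roof T s - roof S s"
      using roof_gt[of T s] roof_eq[of S s] assms interior by auto
    show "roof T p - roof S p = 0" if "p \<in> S - {s}" for p
      using roof_eq[of T p] roof_eq[of S p] assms interior that by auto
    show "\<exists>U\<in>\<Phi>. roof U x < roof S x" if "roof T x - roof S x < 0" for x
      using that interior by force
  qed
qed

text \<open>Up to positive factors, the wall functionals are dual to the points of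
  \<open>S\<close>.\<close>

lemma independent_facet:
  assumes "S \<in> \<Phi>"
  shows "\<not> affine_dependent S"
proof (rule affine_independentI)
  show "\<exists>f. affine_fun f \<and> f s \<noteq> 0 \<and> (\<forall>t\<in>S - {s}. f t = 0)" if "s \<in> S" for s
    by (rule wall_functional[OF assms that]) (metis less_irrefl)
qed (simp add: assms finite_facet)

lemma independent_face: "S \<in> \<Phi> \<Longrightarrow> F \<subseteq> S \<Longrightarrow> \<not> affine_dependent F"
  using independent_facet affine_dependent_subset by blast

lemma union_facets: "(\<Union>S\<in>\<Phi>. convex hull S) = convex hull V"
proof
  show "(\<Union>S\<in>\<Phi>. convex hull S) \<subseteq> convex hull V"
    using points_in_hull by (simp add: SUP_least Sup_le_iff hull_minimal)
  show "convex hull V \<subseteq> (\<Union>S\<in>\<Phi>. convex hull S)"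
  proof
    fix x assume x: "x \<in> convex hull V"
    \<comment> \<open>The facet whose roof is lowest at \<open>x\<close> will turn out to contain
      \<open>x\<close>.\<close>
    obtain S where S: "S \<in> \<Phi>" "\<And>T. T \<in> \<Phi> \<Longrightarrow> roof S x \<le> roof T x"
      using arg_min_if_finite(1)[OF finite_facets facets_nonempty, of "\<lambda>S. roof S x"]
        arg_min_least[OF finite_facets facets_nonempty, of _ "\<lambda>S. roof S x"] by blast
    have "S \<subseteq> affine hull V"
      using S(1) points_in_hull convex_hull_subset_affine_hull by blast
    then have "affine hull S = affine hull V"
      by (simp add: affine_hull_eq_of_card_eq card_facet S independent independent_facet)
    then have "x \<in> affine hull S"
      using x convex_hull_subset_affine_hull by blast
    then obtain u where u: "sum u S = 1" "(\<Sum>v\<in>S. u v *\<^sub>R v) = x"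
      using affine_hull_finite[OF finite_facet[OF S(1)]] by auto
    \<comment> \<open>Up to the positive factor \<open>f s\<close>, the affine coordinate
      \<open>u s\<close> is the wall functional at \<open>x\<close>; a negative value would produce
      a roof below the lowest one.\<close>
    have "0 \<le> u s" if "s \<in> S" for s
    proof (rule wall_functional[OF S(1) that])
      fix f assume f: "affine_fun f" "0 < f s" "\<And>p. p \<in> S - {s} \<Longrightarrow> f p = 0"
        and neg: "\<And>x. x \<in> convex hull V \<Longrightarrow> f x < 0 \<Longrightarrow> \<exists>T\<in>\<Phi>. roof T x < roof S x"
      have "f x = (\<Sum>v\<in>S. u v * f v)"
        using affine_fun_combination[OF f(1) u(1), of "\<lambda>x. x"] u by simp
      also have "\<dots> = u s * f s + (\<Sum>v\<in>S - {s}. u v * f v)"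
        using that finite_facet[OF S(1)] by (simp add: sum.remove)
      also have "(\<Sum>v\<in>S - {s}. u v * f v) = 0"
        by (rule sum.neutral) (use f in auto)
      finally have "f x = u s * f s"
        by simp
      moreover have "0 \<le> f x"
        using neg[OF x] S(2) by (meson linorder_not_le)
      ultimately show "0 \<le> u s"
        using f(2) by (simp add: zero_le_mult_iff)
    qed
    then have "x \<in> convex hull S"
      using u convex_hull_finite[OF finite_facet[OF S(1)]] by auto
    then show "x \<in> (\<Union>S\<in>\<Phi>. convex hull S)"
      using S(1) by blast
  qed
qed

text \<open>At the points of \<open>S\<close>, \<open>roof S\<close> is the height, so
  \<open>roof T - roof S\<close> is nonnegative there and positive off \<open>T\<close>. Averaging
  over \<open>F\<close> gives the inequality; equality forces the weights of all points outside
  \<open>T\<close> to vanish.\<close>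

lemma roof_le_roof_on_face:
  assumes "S \<in> \<Phi>" "T \<in> \<Phi>" "F \<subseteq> S" "x \<in> convex hull F"
  shows "roof S x \<le> roof T x" and "roof T x \<le> roof S x \<Longrightarrow> x \<in> convex hull (F \<inter> T)"
proof -
  have fin: "finite F"
    using assms finite_facet finite_subset by blast
  obtain u where u: "\<forall>v\<in>F. 0 \<le> u v" "sum u F = 1" "(\<Sum>v\<in>F. u v *\<^sub>R v) = x"
    using assms(4) convex_hull_finite[OF fin] by auto
  have eq: "roof T x - roof S x = (\<Sum>v\<in>F. u v * (roof T v - roof S v))"
    using affine_fun_combination[OF affine_fun_diff[OF affine_roof[OF assms(2)] affine_roof[OF assms(1)]] u(2), of "\<lambda>x. x"] u
    by simp
  have le: "0 \<le> roof T v - roof S v" if "v \<in> F" for v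
    using that assms roof_eq[of S v] roof_ge[of T v] by fastforce
  show "roof S x \<le> roof T x"
    using eq sum_nonneg[of F "\<lambda>v. u v * (roof T v - roof S v)"] u le by simp
  assume "roof T x \<le> roof S x"
  then have "(\<Sum>v\<in>F. u v * (roof T v - roof S v)) = 0"
    using eq sum_nonneg[of F "\<lambda>v. u v * (roof T v - roof S v)"] u le by simp
  then have "\<forall>v\<in>F. u v * (roof T v - roof S v) = 0"
    using sum_nonneg_eq_0_iff[OF fin, of "\<lambda>v. u v * (roof T v - roof S v)"] u le by simp
  moreover have "roof T v - roof S v \<noteq> 0" if "v \<in> F - T" for v
    using that assms roof_eq[of S v] roof_gt[of T v] by force
  ultimately have 0: "u v = 0" if "v \<in> F - T" for v
    using that by auto
  have "sum u (F \<inter> T) = 1" "(\<Sum>v\<in>F \<inter> T. u v *\<^sub>R v) = x"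
    using sum.mono_neutral_right[OF fin, of "F \<inter> T" u] sum.mono_neutral_right[OF fin, of "F \<inter> T" "\<lambda>v. u v *\<^sub>R v"] u 0
    by auto
  then show "x \<in> convex hull (F \<inter> T)"
    using u convex_hull_finite[of "F \<inter> T"] fin by auto
qed

text \<open>At a common point each roof is at most the other, so the point lies in the hulls of
  \<open>F \<inter> T\<close> and \<open>G \<inter> S\<close>. Both are subsets of the independent
  set \<open>T\<close>, where hulls of subsets intersect as the subsets do.\<close>

lemma convex_hull_Int_faces:
  assumes "S \<in> \<Phi>" "T \<in> \<Phi>" "F \<subseteq> S" "G \<subseteq> T"
  shows "convex hull F \<inter> convex hull G = convex hull (F \<inter> G)"
proof
  show "convex hull (F \<inter> G) \<subseteq> convex hull F \<inter> convex hull G"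
    by (simp add: hull_mono)
  show "convex hull F \<inter> convex hull G \<subseteq> convex hull (F \<inter> G)"
  proof
    fix x assume x: "x \<in> convex hull F \<inter> convex hull G"
    have "x \<in> convex hull (F \<inter> T)" "x \<in> convex hull (G \<inter> S)"
      using x roof_le_roof_on_face[OF assms(1,2,3)] roof_le_roof_on_face[OF assms(2,1,4)] by auto
    moreover have "\<not> affine_dependent ((F \<inter> T) \<union> (G \<inter> S))"
      by (rule independent_face[OF assms(2)]) (use assms in auto)
    ultimately have "x \<in> convex hull ((F \<inter> T) \<inter> (G \<inter> S))"
      using convex_hull_Int by blast
    then show "x \<in> convex hull (F \<inter> G)"
      by (rule subsetD[OF hull_mono, rotated]) auto
  qed
qed

lemma face_complexE:
  assumes "C \<in> face_complex \<Phi>"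
  obtains F S where "S \<in> \<Phi>" "F \<subseteq> S" "C = convex hull F" "\<not> affine_dependent F"
  using assms independent_face unfolding face_complex_def by blast

lemma face_complexI: "S \<in> \<Phi> \<Longrightarrow> F \<subseteq> S \<Longrightarrow> convex hull F \<in> face_complex \<Phi>"
  unfolding face_complex_def by blast

lemma simplicial_complex_face_complex: "simplicial_complex (face_complex \<Phi>)"
  unfolding simplicial_complex_def
proof (intro conjI allI ballI impI)
  have "face_complex \<Phi> = (\<lambda>F. convex hull F) ` (\<Union>S\<in>\<Phi>. Pow S)"
    unfolding face_complex_def by auto
  then show "finite (face_complex \<Phi>)"
    using finite_facets finite_facet by auto
  \<comment> \<open>The dimension is \<open>card F - 1\<close> as an integer, so the empty face
    counts as a (-1)-simplex.\<close>
  show "\<exists>n. n simplex C" if "C \<in> face_complex \<Phi>" for C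
    using that by (elim face_complexE) (metis diff_add_cancel simplex_def)
  show "F \<in> face_complex \<Phi>" if "C \<in> face_complex \<Phi> \<and> F face_of C" for F C
    using that face_complexI
    by (elim conjE face_complexE) (metis face_of_convex_hull_affine_independent order_trans)
  show "C \<inter> D face_of C" if CD: "C \<in> face_complex \<Phi> \<and> D \<in> face_complex \<Phi>" for C D
  proof -
    obtain F S where F: "S \<in> \<Phi>" "F \<subseteq> S" "C = convex hull F" "\<not> affine_dependent F"
      by (rule face_complexE[OF CD[THEN conjunct1]])
    obtain G T where G: "T \<in> \<Phi>" "G \<subseteq> T" "D = convex hull G"
      by (rule face_complexE[OF CD[THEN conjunct2]])
    show ?thesis
      using convex_hull_Int_faces[OF F(1) G(1) F(2) G(2)] F G
      by (auto simp: face_of_convex_hull_affine_independent)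
  qed
qed

lemma Union_face_complex: "\<Union>(face_complex \<Phi>) = convex hull V"
proof -
  have "\<Union>(face_complex \<Phi>) = (\<Union>S\<in>\<Phi>. convex hull S)"
    unfolding face_complex_def by (auto dest: hull_mono[THEN subsetD, rotated])
  then show ?thesis
    by (simp add: union_facets)
qed

lemma complex_vertices_face_complex: "complex_vertices (face_complex \<Phi>) = \<Union>\<Phi>"
proof
  show "\<Union>\<Phi> \<subseteq> complex_vertices (face_complex \<Phi>)"
    unfolding complex_vertices_def using face_complexI[of _ "{_}"] by force
  show "complex_vertices (face_complex \<Phi>) \<subseteq> \<Union>\<Phi>"
  proof
    fix x assume "x \<in> complex_vertices (face_complex \<Phi>)"
    then have "{x} \<in> face_complex \<Phi>"
      by (simp add: complex_vertices_def)
    then obtain F S where F: "S \<in> \<Phi>" "F \<subseteq> S" "{x} = convex hull F"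
      by (rule face_complexE)
    then have "F = {x}"
      by (metis convex_hull_eq_empty hull_subset insert_not_empty subset_singletonD)
    then show "x \<in> \<Union>\<Phi>"
      using F by auto
  qed
qed

lemma facet_in_complex_facets:
  assumes "S \<in> \<Phi>" "card V = d + 1"
  shows "convex hull S \<in> complex_facets d (face_complex \<Phi>)"
  unfolding complex_facets_def
  using assms independent_facet[OF assms(1)]
  by (auto simp: card_facet intro!: face_complexI simplex_convex_hull)

end

subsection \<open>Sperner labellings and stellar subdivision\<close>

text \<open>A Sperner labelling by \<open>{1..d + 1}\<close> is encoded as the map sending a point to the vertex of
  the ambient simplex that carries its label.\<close>

definition sperner_map :: "'a::euclidean_space set \<Rightarrow> 'a set set \<Rightarrow> ('a \<Rightarrow> 'a) \<Rightarrow> bool" where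
  "sperner_map V \<Phi> m \<longleftrightarrow> (\<forall>p\<in>\<Union>\<Phi>. \<forall>W\<subseteq>V. p \<in> convex hull W \<longrightarrow> m p \<in> W)"

text \<open>\<open>\<Phi> \<noteq> {\<sigma>}\<close> supplies a facet other than
  \<open>\<sigma>\<close>, to be subdivided when further vertices are wanted.\<close>

definition rainbow_elsewhere :: "'a::euclidean_space set \<Rightarrow> 'a set set \<Rightarrow> 'a set \<Rightarrow> bool" where
  "rainbow_elsewhere V \<Phi> \<sigma> \<longleftrightarrow>
     \<sigma> \<in> \<Phi> \<and> \<Phi> \<noteq> {\<sigma>} \<and> (\<forall>m. sperner_map V \<Phi> m \<longrightarrow> (\<exists>\<tau>\<in>\<Phi>. \<tau> \<noteq> \<sigma> \<and> inj_on m \<tau>))"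

text \<open>Finitely many strict inequalities that hold at 0 persist, by continuity, for all small
  positive parameters.\<close>

lemma exists_small_perturbation:
  fixes A B :: "'b \<Rightarrow> real"
  assumes "finite X" "\<And>x. x \<in> X \<Longrightarrow> 0 < A x"
  obtains \<epsilon> where "0 < \<epsilon>" "\<And>x. x \<in> X \<Longrightarrow> 0 < A x + \<epsilon> * B x"
proof -
  have "eventually (\<lambda>\<epsilon>. 0 < A x + \<epsilon> * B x) (at_right 0)" if "x \<in> X" for x
  proof -
    have "((\<lambda>\<epsilon>. A x + \<epsilon> * B x) \<longlongrightarrow> A x + 0 * B x) (at_right 0)"
      by (intro tendsto_intros)
    then show ?thesis
      using assms(2)[OF that] by (auto dest: order_tendstoD(1))
  qed
  then have "eventually (\<lambda>\<epsilon>. \<forall>x\<in>X. 0 < A x + \<epsilon> * B x) (at_right 0)"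
    using assms(1) by (simp add: eventually_ball_finite)
  then have "eventually (\<lambda>\<epsilon>. 0 < \<epsilon> \<and> (\<forall>x\<in>X. 0 < A x + \<epsilon> * B x)) (at_right 0)"
    by (intro eventually_conj eventually_at_right_less)
  then show ?thesis
    using that eventually_happens'[OF trivial_limit_at_right_real] by blast
qed

context regular_subdivision
begin

text \<open>The new vertex \<open>w\<close>, the barycentre of \<open>\<tau>\<close>, is lifted
  slightly above \<open>roof \<tau>\<close>. The facet that replaces \<open>u\<close> by
  \<open>w\<close> gets \<open>roof \<tau>\<close> tilted by a small multiple of the barycentric
  coordinate of \<open>u\<close>. For small \<open>\<epsilon>\<close> all other strict inequalities
  survive.\<close>

lemma stellar_subdivision:
  assumes \<tau>: "\<tau> \<in> \<Phi>" and V2: "2 \<le> card V"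
  obtains w h' where "w \<notin> \<Union>\<Phi>"
    "\<Union>(\<Phi> - {\<tau>} \<union> (\<lambda>u. insert w (\<tau> - {u})) ` \<tau>) = insert w (\<Union>\<Phi>)"
    "regular_facets V h' (\<Phi> - {\<tau>} \<union> (\<lambda>u. insert w (\<tau> - {u})) ` \<tau>)"
proof -
  define n where "n = card \<tau>"
  have n: "n = card V" "2 \<le> n"
    using card_facet[OF \<tau>] V2 by (auto simp: n_def)
  have fin: "finite \<tau>"
    using finite_facet[OF \<tau>] .
  define w where "w = (\<Sum>p\<in>\<tau>. (1 / n) *\<^sub>R p)"
  have sum1: "(\<Sum>p\<in>\<tau>. 1 / real n) = 1"
    using n by (simp add: n_def)
  have w: "f w = (\<Sum>p\<in>\<tau>. f p) / n" if "affine_fun f" for f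
    using affine_fun_combination[OF that sum1, of "\<lambda>p. p"] by (simp add: w_def sum_divide_distrib)
  \<comment> \<open>This gives \<open>c u\<close>, the barycentric coordinate of \<open>u\<close>
    with respect to \<open>\<tau>\<close>; at the barycentre it is \<open>1 / n\<close>.\<close>
  have "\<exists>f. affine_fun f \<and> (\<forall>p\<in>\<tau>. f p = (if p = u then 1 else 0))" for u
    by (rule affine_fun_extend[OF independent_facet[OF \<tau>], of "\<lambda>p. if p = u then 1 else 0"]) auto
  then obtain c :: "'a \<Rightarrow> 'a \<Rightarrow> real" where c: "\<And>u. affine_fun (c u)"
    "\<And>u p. p \<in> \<tau> \<Longrightarrow> c u p = (if p = u then 1 else 0)"
    by metis
  have cw: "c u w = 1 / n" if "u \<in> \<tau>" for u
  proof -
    have "(\<Sum>p\<in>\<tau>. c u p) = (\<Sum>p\<in>\<tau>. if p = u then 1 else 0)"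
      by (rule sum.cong) (auto simp: c)
    then show ?thesis
      using that fin by (simp add: w[OF c(1)])
  qed
  have w_hull: "w \<in> convex hull \<tau>"
    using sum1 unfolding convex_hull_finite[OF fin] w_def by (auto intro!: exI[of _ "\<lambda>_. 1 / real n"])
  have "w \<notin> \<tau>"
    using cw[of w] c(2)[of w w] n by auto
  \<comment> \<open>Hulls of faces of two facets meet in the hull of the common points, here of
    \<open>\<tau> \<inter> {w} = {}\<close>.\<close>
  have w_new: "w \<notin> \<Union>\<Phi>"
  proof
    assume "w \<in> \<Union>\<Phi>"
    then obtain S where "S \<in> \<Phi>" "w \<in> S"
      by blast
    then have "w \<in> convex hull (\<tau> \<inter> {w})"
      using convex_hull_Int_faces[OF \<tau> \<open>S \<in> \<Phi>\<close>, of \<tau> "{w}"] w_hull by auto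
    then show False
      using \<open>w \<notin> \<tau>\<close> by simp
  qed
  define N where "N u = insert w (\<tau> - {u})" for u
  define \<Psi> where "\<Psi> = \<Phi> - {\<tau>} \<union> N ` \<tau>"
  have points: "\<Union>\<Psi> = insert w (\<Union>\<Phi>)"
  proof
    show "\<Union>\<Psi> \<subseteq> insert w (\<Union>\<Phi>)"
      using \<tau> by (auto simp: \<Psi>_def N_def)
    have "\<exists>u\<in>\<tau>. p \<in> N u" if "p \<in> insert w \<tau>" for p
    proof -
      \<comment> \<open>Since \<open>\<tau>\<close> has at least two points, some
        \<open>u \<noteq> p\<close> can be removed; thus no old point is lost.\<close>
      have "\<not> \<tau> \<subseteq> {p}"
        using card_mono[of "{p}" \<tau>] n by (auto simp: n_def)
      then show ?thesis
        using that by (auto simp: N_def)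
    qed
    then show "insert w (\<Union>\<Phi>) \<subseteq> \<Union>\<Psi>"
      unfolding \<Psi>_def by blast
  qed
  have N_ne: "N u \<noteq> S" if "S \<in> \<Phi>" for u S
    using w_new that by (auto simp: N_def)
  \<comment> \<open>\<open>w\<close> averages \<open>\<tau>\<close>, where
    \<open>roof \<tau>\<close> is at most \<open>roof S\<close>, strictly at a point of
    \<open>\<tau>\<close> outside \<open>S\<close>.\<close>
  have roof_w: "roof \<tau> w < roof S w" if S: "S \<in> \<Phi> - {\<tau>}" for S
  proof -
    obtain q where q: "q \<in> \<tau>" "q \<notin> S"
      using facet_eq[OF \<tau>, of S] S by auto
    have "(\<Sum>p\<in>\<tau>. roof \<tau> p) < (\<Sum>p\<in>\<tau>. roof S p)"
    proof (rule sum_strict_mono_ex1[OF fin])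
      show "\<forall>p\<in>\<tau>. roof \<tau> p \<le> roof S p"
        using roof_eq[OF \<tau>] roof_ge[of S] S \<tau> by auto
      show "\<exists>p\<in>\<tau>. roof \<tau> p < roof S p"
        using roof_eq[OF \<tau> q(1)] roof_gt[of S q] q S \<tau> by (intro bexI[of _ q]) auto
    qed
    then show ?thesis
      using S n by (simp add: w affine_roof \<tau> divide_strict_right_mono)
  qed
  obtain \<epsilon>1 where \<epsilon>1: "0 < \<epsilon>1" "\<And>S. S \<in> \<Phi> - {\<tau>} \<Longrightarrow> 0 < (roof S w - roof \<tau> w) + \<epsilon>1 * (- 1)"
    by (rule exists_small_perturbation[of "\<Phi> - {\<tau>}" "\<lambda>S. roof S w - roof \<tau> w" "\<lambda>_. -1"])
      (use finite_facets roof_w in auto)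
  have "finite (\<tau> \<times> (\<Union>\<Phi> - \<tau>))"
    using finite_points fin by blast
  moreover have "0 < roof \<tau> (snd x) - h (snd x)" if "x \<in> \<tau> \<times> (\<Union>\<Phi> - \<tau>)" for x
    using roof_gt[OF \<tau>, of "snd x"] that by (simp add: mem_Times_iff)
  ultimately obtain \<epsilon>2 where \<epsilon>2: "0 < \<epsilon>2" "\<And>x. x \<in> \<tau> \<times> (\<Union>\<Phi> - \<tau>) \<Longrightarrow>
      0 < (roof \<tau> (snd x) - h (snd x)) + \<epsilon>2 * (n * c (fst x) (snd x))"
    using exists_small_perturbation[of "\<tau> \<times> (\<Union>\<Phi> - \<tau>)" "\<lambda>x. roof \<tau> (snd x) - h (snd x)"
        "\<lambda>x. n * c (fst x) (snd x)"] by blast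
  \<comment> \<open>\<open>\<epsilon>1\<close> keeps the lifted \<open>w\<close> below the roofs of
    the other facets, \<open>\<epsilon>2\<close> keeps the old points off \<open>\<tau>\<close>
    below the tilted roofs. The minimum does both: a nonnegative tilt is harmless, and a negative
    one only gets weaker.\<close>
  define \<epsilon> where "\<epsilon> = min \<epsilon>1 \<epsilon>2"
  have \<epsilon>: "0 < \<epsilon>" "\<And>S. S \<in> \<Phi> - {\<tau>} \<Longrightarrow> roof \<tau> w + \<epsilon> < roof S w"
    using \<epsilon>1 \<epsilon>2(1) by (force simp: \<epsilon>_def)+
  have \<epsilon>c: "h p < roof \<tau> p + \<epsilon> * n * c u p" if u: "u \<in> \<tau>" and p: "p \<in> \<Union>\<Phi> - \<tau>" for u p
  proof (cases "0 \<le> c u p")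
    case True
    then have "0 \<le> \<epsilon> * n * c u p"
      using \<epsilon>(1) by simp
    then show ?thesis
      using roof_gt[OF \<tau>, of p] p by auto
  next
    case False
    then have "\<epsilon>2 * (n * c u p) \<le> \<epsilon> * (n * c u p)"
      by (intro mult_right_mono_neg) (auto simp: \<epsilon>_def mult_nonneg_nonpos)
    then show ?thesis
      using \<epsilon>2(2)[of "(u, p)"] u p by (simp add: mult.assoc)
  qed
  define h' where "h' = h(w := roof \<tau> w + \<epsilon>)"
  have h'_old: "h' p = h p" if "p \<in> \<Union>\<Phi>" for p
    using that w_new by (auto simp: h'_def)
  have h'_\<tau>: "h' p = roof \<tau> p" if "p \<in> \<tau>" for p
    using roof_eq[OF \<tau> that] h'_old[OF UnionI[OF \<tau> that]] by simp
  have h'_w: "h' w = roof \<tau> w + \<epsilon>"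
    by (simp add: h'_def)
  have "regular_facets V h' \<Psi>"
    unfolding regular_facets_def
  proof (intro conjI ballI)
    show "finite \<Psi>" "\<Psi> \<noteq> {}"
      using finite_facets fin n by (auto simp: \<Psi>_def n_def)
    show "V \<subseteq> \<Union>\<Psi>" "\<Union>\<Psi> \<subseteq> convex hull V"
      using V_subset points_in_hull w_hull union_facets \<tau> by (auto simp: points)
    fix S assume "S \<in> \<Psi>"
    then consider (old) "S \<in> \<Phi>" "S \<noteq> \<tau>" | (new) u where "u \<in> \<tau>" "S = N u"
      by (auto simp: \<Psi>_def)
    note S_cases = this
    show "card S = card V"
      using S_cases
    proof cases
      case new
      then show ?thesis
        using fin \<open>w \<notin> \<tau>\<close> n by (simp add: N_def n_def)
    qed (simp add: card_facet)
    show "\<exists>g. affine_fun g \<and> (\<forall>p\<in>S. g p = h' p) \<and> (\<forall>p\<in>\<Union>\<Psi> - S. h' p < g p)"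
      using S_cases
    proof cases
      case old
      have "roof S p = h' p" if "p \<in> S" for p
        using roof_eq[OF old(1) that] h'_old[OF UnionI[OF old(1) that]] by simp
      moreover have "h' p < roof S p" if "p \<in> \<Union>\<Psi> - S" for p
        using that old \<epsilon>(2)[of S] roof_gt[OF old(1), of p] h'_old[of p] h'_w by (cases "p = w") (auto simp: points)
      ultimately show ?thesis
        using affine_roof[OF old(1)] by blast
    next
      case new
      \<comment> \<open>The factor \<open>n\<close> makes the tilt exactly \<open>\<epsilon>\<close>
        at \<open>w\<close>, where \<open>c u\<close> is \<open>1 / n\<close>.\<close>
      have "affine_fun (\<lambda>x. roof \<tau> x + \<epsilon> * n * c u x)"
        by (intro affine_fun_add affine_fun_scale affine_roof \<tau> c)
      moreover have "roof \<tau> p + \<epsilon> * n * c u p = h' p" if "p \<in> S" for p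
        using that new cw[of u] c(2)[of p u] h'_\<tau>[of p] n \<open>w \<notin> \<tau>\<close>
        by (auto simp: N_def h'_w)
      moreover have "h' p < roof \<tau> p + \<epsilon> * n * c u p" if "p \<in> \<Union>\<Psi> - S" for p
      proof (cases "p = u")
        case True
        then show ?thesis
          using new c(2)[of u u] h'_\<tau>[of u] n \<epsilon>(1) by simp
      next
        case False
        then have "p \<in> \<Union>\<Phi> - \<tau>"
          using that new by (auto simp: points N_def)
        then show ?thesis
          using \<epsilon>c[OF new(1), of p] h'_old[of p] by simp
      qed
      ultimately show ?thesis
        by blast
    qed
    fix s assume s: "s \<in> S"
    show "(\<exists>b. affine_fun b \<and> (\<forall>v\<in>V. 0 \<le> b v) \<and> 0 < b s \<and> (\<forall>p\<in>S - {s}. b p = 0)) \<or>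
          (\<exists>T\<in>\<Psi>. T \<noteq> S \<and> S - {s} \<subseteq> T)"
      using S_cases
    proof cases
      case old
      from old(1) s show ?thesis
      proof (cases rule: wall_cases)
        case (interior T)
        show ?thesis
        proof (cases "T = \<tau>")
          case True
          \<comment> \<open>The former neighbour \<open>\<tau>\<close> is gone, but the wall has too
            few points to exhaust it; removing a point \<open>u\<close> off the wall leaves a new
            cell \<open>N u\<close> that contains the wall.\<close>
          have "card (S - {s}) < card \<tau>"
            using s old card_facet[of S] card_facet[OF \<tau>] finite_facet[of S]
            by (metis card_Diff1_less)
          then obtain u where "u \<in> \<tau>" "u \<notin> S - {s}"
            using interior(3) True by (metis card_mono finite_facet old(1) finite_Diff not_less subsetI)
          then have "N u \<in> \<Psi>" "N u \<noteq> S" "S - {s} \<subseteq> N u"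
            using interior(3) True N_ne old by (auto simp: N_def \<Psi>_def)
          then show ?thesis
            by blast
        next
          case False
          then show ?thesis
            using interior by (auto simp: \<Psi>_def)
        qed
      qed blast
    next
      case new
      show ?thesis
      proof (cases "s = w")
        case True
        \<comment> \<open>The wall opposite \<open>w\<close> is the wall of \<open>\<tau>\<close>
          opposite \<open>u\<close> and inherits its boundary functional or its neighbour.\<close>
        have *: "S - {s} = \<tau> - {u}"
          using new True \<open>w \<notin> \<tau>\<close> by (auto simp: N_def)
        from \<tau> new(1) show ?thesis
        proof (cases rule: wall_cases)
          case (boundary b)
          have "(\<Sum>p\<in>\<tau>. b p) = b u + (\<Sum>p\<in>\<tau> - {u}. b p)"
            using fin new(1) by (simp add: sum.remove)
          also have "(\<Sum>p\<in>\<tau> - {u}. b p) = 0"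
            by (rule sum.neutral) (use boundary in auto)
          finally have "0 < b w"
            using w[OF boundary(1)] boundary(3) n by simp
          then show ?thesis
            using boundary * True by blast
        next
          case (interior T)
          then show ?thesis
            using * new N_ne[of T u] by (auto simp: \<Psi>_def)
        qed
      next
        case False
        \<comment> \<open>The wall of \<open>N u\<close> opposite an old point \<open>s\<close> is
          shared with \<open>N s\<close>.\<close>
        then have "N s \<in> \<Psi>" "S - {s} \<subseteq> N s" "u \<in> N s" "u \<notin> S"
          using s new \<open>w \<notin> \<tau>\<close> by (auto simp: N_def \<Psi>_def)
        then show ?thesis
          by blast
      qed
    qed
  qed
  then show ?thesis
    using that[of w h'] w_new points unfolding \<Psi>_def N_def by blast
qed

lemma rainbow_elsewhere_stellar:
  assumes \<sigma>: "rainbow_elsewhere V \<Phi> \<sigma>" and \<tau>: "\<tau> \<in> \<Phi>" "\<tau> \<noteq> \<sigma>" and w: "w \<notin> \<Union>\<Phi>"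
    and \<Psi>: "\<Psi> = \<Phi> - {\<tau>} \<union> (\<lambda>u. insert w (\<tau> - {u})) ` \<tau>" "\<Union>\<Psi> = insert w (\<Union>\<Phi>)" "\<Union>\<Psi> \<subseteq> convex hull V"
  shows "rainbow_elsewhere V \<Psi> \<sigma>"
  unfolding rainbow_elsewhere_def
proof (intro conjI allI impI)
  show "\<sigma> \<in> \<Psi>"
    using \<sigma> \<tau> by (auto simp: rainbow_elsewhere_def \<Psi>(1))
  have "w \<notin> \<sigma>"
    using w \<sigma> by (auto simp: rainbow_elsewhere_def)
  then show "\<Psi> \<noteq> {\<sigma>}"
    using \<Psi>(2) by auto
  fix m assume m: "sperner_map V \<Psi> m"
  then have "sperner_map V \<Phi> m"
    by (auto simp: sperner_map_def \<Psi>(2))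
  then obtain \<rho> where \<rho>: "\<rho> \<in> \<Phi>" "\<rho> \<noteq> \<sigma>" "inj_on m \<rho>"
    using \<sigma> by (auto simp: rainbow_elsewhere_def)
  show "\<exists>\<tau>\<in>\<Psi>. \<tau> \<noteq> \<sigma> \<and> inj_on m \<tau>"
  proof (cases "\<rho> = \<tau>")
    case True
    have in_V: "m p \<in> V" if "p \<in> insert w \<tau>" for p
    proof -
      have "p \<in> \<Union>\<Psi>"
        using that \<tau>(1) \<Psi>(2) by auto
      then show ?thesis
        using m \<Psi>(3) by (auto simp: sperner_map_def)
    qed
    \<comment> \<open>\<open>\<tau>\<close> has as many points as \<open>V\<close> and distinct
      images in \<open>V\<close>, so every label occurs on it, also that of
      \<open>w\<close>.\<close>
    then have "m ` \<tau> = V"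
      using \<rho>(3) True by (intro card_subset_eq finite_V) (auto simp: card_image card_facet[OF \<tau>(1)])
    then obtain u where u: "u \<in> \<tau>" "m u = m w"
      using in_V[of w] by auto
    have "inj_on m (insert w (\<tau> - {u}))"
      using \<rho>(3) u True by (auto simp: inj_on_def)
    moreover have "insert w (\<tau> - {u}) \<in> \<Psi>"
      using u(1) by (auto simp: \<Psi>(1))
    ultimately show ?thesis
      using \<open>w \<notin> \<sigma>\<close> by blast
  next
    case False
    then show ?thesis
      using \<rho> by (auto simp: \<Psi>(1))
  qed
qed

end

section \<open>Infinitely many triangulations\<close>

lemma regular_rainbow_elsewhere_many_points:
  fixes V :: "'a::euclidean_space set"
  assumes V: "\<not> affine_dependent V" "2 \<le> card V"
    and "regular_facets V h \<Phi>" "rainbow_elsewhere V \<Phi> \<sigma>"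
  shows "\<exists>h \<Psi>. regular_facets V h \<Psi> \<and> rainbow_elsewhere V \<Psi> \<sigma> \<and> card (\<Union>\<Psi>) = card (\<Union>\<Phi>) + k"
proof (induction k)
  case 0
  then show ?case
    using assms by auto
next
  case (Suc k)
  then obtain h \<Psi> where \<Psi>: "regular_facets V h \<Psi>" "rainbow_elsewhere V \<Psi> \<sigma>" "card (\<Union>\<Psi>) = card (\<Union>\<Phi>) + k"
    by blast
  interpret regular_subdivision V h \<Psi>
    using V \<Psi>(1) by unfold_locales auto
  obtain \<tau> where \<tau>: "\<tau> \<in> \<Psi>" "\<tau> \<noteq> \<sigma>"
    using \<Psi>(2) by (auto simp: rainbow_elsewhere_def)
  obtain w h' where w: "w \<notin> \<Union>\<Psi>"
    and points: "\<Union>(\<Psi> - {\<tau>} \<union> (\<lambda>u. insert w (\<tau> - {u})) ` \<tau>) = insert w (\<Union>\<Psi>)"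
    and reg: "regular_facets V h' (\<Psi> - {\<tau>} \<union> (\<lambda>u. insert w (\<tau> - {u})) ` \<tau>)"
    by (rule stellar_subdivision[OF \<tau>(1) V(2)])
  have "\<Union>(\<Psi> - {\<tau>} \<union> (\<lambda>u. insert w (\<tau> - {u})) ` \<tau>) \<subseteq> convex hull V"
    using reg unfolding regular_facets_def by (elim conjE)
  then have "rainbow_elsewhere V (\<Psi> - {\<tau>} \<union> (\<lambda>u. insert w (\<tau> - {u})) ` \<tau>) \<sigma>"
    by (rule rainbow_elsewhere_stellar[OF \<Psi>(2) \<tau> w refl points])
  moreover have "card (insert w (\<Union>\<Psi>)) = card (\<Union>\<Phi>) + Suc k"
    using w finite_points \<Psi>(3) by simp
  ultimately show ?case
    using reg unfolding points[symmetric] by blast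
qed

text \<open>The hull of any subset \<open>W\<close> of \<open>V\<close> is a face of the ambient
  simplex, so the face condition on \<open>l\<close> makes \<open>v \<circ> l\<close> a Sperner map;
  its injectivity on a facet yields that of \<open>l\<close>.\<close>

lemma (in regular_subdivision) triangulation_of_regular_facets:
  assumes v: "inj_on v {1..d + 1}" and V: "V = v ` {1..d + 1}" and \<sigma>: "rainbow_elsewhere V \<Phi> \<sigma>"
  shows "simplex_triangulation d v (face_complex \<Phi>)"
    and "\<exists>\<sigma>\<in>complex_facets d (face_complex \<Phi>). \<forall>l. sperner_labelling d v (face_complex \<Phi>) l \<longrightarrow>
            (\<exists>\<tau>\<in>complex_facets d (face_complex \<Phi>). \<tau> \<noteq> \<sigma> \<and> rainbow l \<tau>)"
proof -
  have card_V: "card V = d + 1"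
    using v by (simp add: V card_image)
  have \<sigma>_in: "\<sigma> \<in> \<Phi>"
    using \<sigma> by (simp add: rainbow_elsewhere_def)
  show "simplex_triangulation d v (face_complex \<Phi>)"
    using V_subset unfolding simplex_triangulation_def ambient_simplex_def
    by (simp add: simplicial_complex_face_complex Union_face_complex complex_vertices_face_complex V)
  have rainbow: "\<exists>\<tau>\<in>complex_facets d (face_complex \<Phi>). \<tau> \<noteq> convex hull \<sigma> \<and> rainbow l \<tau>"
    if l: "sperner_labelling d v (face_complex \<Phi>) l" for l
  proof -
    have "sperner_map V \<Phi> (v \<circ> l)"
      unfolding sperner_map_def
    proof (intro ballI allI impI)
      fix p W assume p: "p \<in> \<Union>\<Phi>" and W: "W \<subseteq> V" "p \<in> convex hull W"
      have "convex hull W face_of ambient_simplex d v"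
        unfolding ambient_simplex_def V[symmetric]
        using face_of_convex_hull_affine_independent[OF independent] W(1) by blast
      moreover have "vertices (convex hull W) = W"
        using W(1) independent affine_dependent_subset vertices_convex_hull by blast
      ultimately obtain w where w: "w \<in> W" "l p = l w"
        using l p W(2) unfolding sperner_labelling_def complex_vertices_face_complex by blast
      \<comment> \<open>Since \<open>l (v i) = i\<close>, the map \<open>v \<circ> l\<close> fixes
        \<open>w\<close>, and hence sends \<open>p\<close> to \<open>w\<close>.\<close>
      then obtain i where "i \<in> {1..d + 1}" "w = v i"
        using W(1) V by blast
      then show "(v \<circ> l) p \<in> W"
        using l w by (auto simp: sperner_labelling_def)
    qed
    then obtain \<tau> where \<tau>: "\<tau> \<in> \<Phi>" "\<tau> \<noteq> \<sigma>" "inj_on (v \<circ> l) \<tau>"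
      using \<sigma> by (auto simp: rainbow_elsewhere_def)
    have "rainbow l (convex hull \<tau>)"
      using \<tau>(3) by (simp add: rainbow_def vertices_convex_hull[OF independent_facet[OF \<tau>(1)]] inj_on_imageI2)
    \<comment> \<open>Independent sets are recovered from their hulls as the extreme points.\<close>
    moreover have "convex hull \<tau> \<noteq> convex hull \<sigma>"
      using \<tau>(1,2) \<sigma>_in vertices_convex_hull independent_facet by metis
    ultimately show ?thesis
      using facet_in_complex_facets[OF \<tau>(1) card_V] by blast
  qed
  show "\<exists>\<sigma>\<in>complex_facets d (face_complex \<Phi>). \<forall>l. sperner_labelling d v (face_complex \<Phi>) l \<longrightarrow>
            (\<exists>\<tau>\<in>complex_facets d (face_complex \<Phi>). \<tau> \<noteq> \<sigma> \<and> rainbow l \<tau>)"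
    by (rule bexI[OF _ facet_in_complex_facets[OF \<sigma>_in card_V]]) (use rainbow in blast)
qed

text \<open>The \<open>k\<close>-th complex has exactly \<open>k\<close> vertices more than the
  initial one. An isomorphism preserves the number of vertices, so one count shows both that the
  complexes differ and that no two are isomorphic.\<close>

lemma triangulations_from_one:
  fixes v :: "nat \<Rightarrow> 'a::euclidean_space"
  assumes d: "1 \<le> d" and v: "inj_on v {1..d + 1}" "\<not> affine_dependent (v ` {1..d + 1})"
    and \<Phi>: "regular_facets (v ` {1..d + 1}) h \<Phi>" "rainbow_elsewhere (v ` {1..d + 1}) \<Phi> \<sigma>"
  shows "\<exists>\<K>. infinite \<K> \<and>
    pairwise (\<lambda>K L. \<not> combinatorially_isomorphic K L) \<K> \<and>
    (\<forall>K\<in>\<K>. simplex_triangulation d v K \<and>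
       (\<exists>\<sigma>\<in>complex_facets d K.
          \<forall>l. sperner_labelling d v K l \<longrightarrow>
            (\<exists>\<tau>\<in>complex_facets d K. \<tau> \<noteq> \<sigma> \<and> rainbow l \<tau>)))"
proof -
  define V where "V = v ` {1..d + 1}"
  have V: "\<not> affine_dependent V" "2 \<le> card V"
    using d v by (auto simp: V_def card_image)
  obtain H \<Psi> where \<Psi>: "\<And>k. regular_facets V (H k) (\<Psi> k)" "\<And>k. rainbow_elsewhere V (\<Psi> k) \<sigma>"
    "\<And>k::nat. card (\<Union>(\<Psi> k)) = card (\<Union>\<Phi>) + k"
    using regular_rainbow_elsewhere_many_points[OF V, of h \<Phi> \<sigma>] \<Phi> unfolding V_def[symmetric] by metis
  have reg: "regular_subdivision V (H k) (\<Psi> k)" for k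
    using V \<Psi>(1) by unfold_locales auto
  have card: "card (complex_vertices (face_complex (\<Psi> k))) = card (\<Union>\<Phi>) + k" for k
    using regular_subdivision.complex_vertices_face_complex[OF reg] \<Psi>(3) by metis
  have eq: "j = k" if iso: "combinatorially_isomorphic (face_complex (\<Psi> j)) (face_complex (\<Psi> k))" for j k
  proof -
    obtain f where "bij_betw f (complex_vertices (face_complex (\<Psi> j))) (complex_vertices (face_complex (\<Psi> k)))"
      using iso unfolding combinatorially_isomorphic_def by blast
    from bij_betw_same_card[OF this] show ?thesis
      by (simp add: card)
  qed
  have "inj (\<lambda>k. face_complex (\<Psi> k))"
    by (rule injI) (metis add_left_cancel card)
  then have "infinite (range (\<lambda>k. face_complex (\<Psi> k)))"
    using finite_imageD by blast
  moreover have "pairwise (\<lambda>K L. \<not> combinatorially_isomorphic K L) (range (\<lambda>k. face_complex (\<Psi> k)))"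
    using eq by (auto simp: pairwise_def)
  ultimately show ?thesis
    using regular_subdivision.triangulation_of_regular_facets[OF reg v(1) V_def \<Psi>(2)]
    by (intro exI[of _ "range (\<lambda>k. face_complex (\<Psi> k))"]) auto
qed

subsection \<open>The example\<close>

text \<open>
  Rows of \<open>node_coords\<close> are barycentric coordinates, multiplied by 7, with respect to
  \<open>v 1, \<dots>, v 4\<close>. Each cell lists the indices of its four nodes and the values at
  \<open>v 1, \<dots>, v 4\<close> of the affine functional supporting the lifted cell; the heights are scaled so
  that these values are integers, and
  \<open>node_heights\<close> and \<open>functional_value\<close> carry the same factor 7. The data were found by a computer search.
\<close>

definition node_coords :: "nat list list" where
  "node_coords =
    [[7,0,0,0], [0,7,0,0], [0,0,7,0], [0,0,0,7],
     [0,3,4,0], [0,5,2,0], [2,0,0,5], [1,3,2,1], [2,0,1,4]]"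

definition node_heights :: "nat list" where
  "node_heights = map ((*) 210) [0,0,0,0,16,11,9,15,14]"

definition cells :: "(nat list \<times> nat list) list" where
  "cells =
    [([0, 1, 5, 7], [0, 0, 1155, 840]),
     ([0, 1, 6, 8], [0, 0, 1428, 378]),
     ([0, 1, 7, 8], [0, 0, 1380, 390]),
     ([0, 2, 4, 8], [0, 1120, 0, 735]),
     ([0, 4, 5, 7], [0, 180, 705, 1200]),
     ([0, 4, 7, 8], [0, 560, 420, 630]),
     ([1, 3, 5, 6], [945, 0, 1155, 0]),
     ([1, 5, 6, 7], [770, 0, 1155, 70]),
     ([1, 6, 7, 8], [420, 0, 1260, 210]),
     ([2, 3, 4, 8], [1470, 1120, 0, 0]),
     ([3, 4, 5, 7], [1200, 180, 705, 0]),
     ([3, 4, 7, 8], [1134, 224, 672, 0]),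
     ([3, 5, 6, 8], [945, 42, 1050, 0]),
     ([3, 5, 7, 8], [980, 70, 980, 0]),
     ([5, 6, 7, 8], [870, 30, 1080, 30])]"

definition functional_value :: "nat list \<Rightarrow> nat \<Rightarrow> nat" where
  "functional_value c j = (\<Sum>i\<leftarrow>[0..<4]. c ! i * node_coords ! j ! i)"

section \<open>Finite checks on the tables\<close>

lemma upt_4: "[0..<4] = [0, 1, 2, 3]"
  and upt_9: "[0..<9] = [0, 1, 2, 3, 4, 5, 6, 7, 8]"
  by code_simp+

lemmas table_simps = cells_def node_coords_def node_heights_def functional_value_def upt_4 upt_9

lemma sum_node_coords: "j < 9 \<Longrightarrow> (\<Sum>i<4. node_coords ! j ! i) = 7"
proof -
  have "\<forall>j\<in>set [0..<9]. (\<Sum>i\<leftarrow>[0..<4]. node_coords ! j ! i) = 7"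
    by code_simp
  then show "j < 9 \<Longrightarrow> (\<Sum>i<4. node_coords ! j ! i) = 7"
    by (simp add: interv_sum_list_conv_sum_set_nat atLeast0LessThan)
qed

lemma node_coords_inj:
  assumes "j < 9" "k < 9" "\<And>i. i < 4 \<Longrightarrow> node_coords ! j ! i = node_coords ! k ! i"
  shows "j = k"
proof -
  have "\<forall>j\<in>set [0..<9]. \<forall>k\<in>set [0..<9].
      (\<forall>i\<in>set [0..<4]. node_coords ! j ! i = node_coords ! k ! i) \<longrightarrow> j = k"
    by code_simp
  then show ?thesis
    using assms by simp
qed

lemma node_coords_vertex: "i < 4 \<Longrightarrow> k < 4 \<Longrightarrow> node_coords ! i ! k = (if k = i then 7 else 0)"
proof -
  have "\<forall>i\<in>set [0..<4]. \<forall>k\<in>set [0..<4]. node_coords ! i ! k = (if k = i then 7 else 0)"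
    by code_simp
  then show "i < 4 \<Longrightarrow> k < 4 \<Longrightarrow> node_coords ! i ! k = (if k = i then 7 else 0)"
    by simp
qed

lemma cell_indices:
  assumes "(F, c) \<in> set cells"
  shows "distinct F" "length F = 4" "set F \<subseteq> {..<9}"
proof -
  have "\<forall>(F, c)\<in>set cells. distinct F \<and> length F = 4 \<and> (\<forall>j\<in>set F. j < 9)"
    by code_simp
  then show "distinct F" "length F = 4" "set F \<subseteq> {..<9}"
    using assms by auto
qed

lemma node_in_cell:
  assumes "j < 9"
  obtains F c where "(F, c) \<in> set cells" "j \<in> set F"
proof -
  have "\<forall>j\<in>set [0..<9]. \<exists>(F, c)\<in>set cells. j \<in> set F"
    by code_simp
  then show ?thesis
    using assms that by fastforce
qed

lemma functional_value_eq:
  assumes "(F, c) \<in> set cells" "j \<in> set F"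
  shows "functional_value c j = node_heights ! j"
proof -
  have "\<forall>(F, c)\<in>set cells. \<forall>j\<in>set F. functional_value c j = node_heights ! j"
    by (simp add: table_simps)
  then show ?thesis
    using assms by auto
qed

lemma functional_value_gt:
  assumes "(F, c) \<in> set cells" "j < 9" "j \<notin> set F"
  shows "node_heights ! j < functional_value c j"
proof -
  have *: "\<forall>(F, c)\<in>set cells. \<forall>j\<in>set [0..<9]. j \<in> set F \<or> node_heights ! j < functional_value c j"
    by (simp add: table_simps)
  have "\<forall>j\<in>set [0..<9]. j \<in> set F \<or> node_heights ! j < functional_value c j"
    using bspec[OF * assms(1)] by (simp only: prod.case)
  then show ?thesis
    using assms(2,3) by auto
qed

text \<open>In the first alternative the wall lies on the boundary, and barycentric coordinate
  \<open>i\<close> serves as the boundary functional that \<open>regular_facets\<close> asks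
  for.\<close>

lemma cell_walls:
  assumes "(F, c) \<in> set cells" "j \<in> set F"
  shows "(\<exists>i<4. 0 < node_coords ! j ! i \<and> (\<forall>k\<in>set F - {j}. node_coords ! k ! i = 0)) \<or>
    (\<exists>(G, e)\<in>set cells. j \<notin> set G \<and> set F - {j} \<subseteq> set G)"
proof -
  have "\<forall>(F, c)\<in>set cells. \<forall>j\<in>set F.
    (\<exists>i\<in>set [0..<4]. 0 < node_coords ! j ! i \<and> (\<forall>k\<in>set F. k \<noteq> j \<longrightarrow> node_coords ! k ! i = 0)) \<or>
    (\<exists>(G, e)\<in>set cells. j \<notin> set G \<and> (\<forall>k\<in>set F. k \<noteq> j \<longrightarrow> k \<in> set G))"
    by (simp add: table_simps)
  from bspec[OF this assms(1)] assms(2)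
  have "(\<exists>i\<in>set [0..<4]. 0 < node_coords ! j ! i \<and> (\<forall>k\<in>set F. k \<noteq> j \<longrightarrow> node_coords ! k ! i = 0)) \<or>
    (\<exists>(G, e)\<in>set cells. j \<notin> set G \<and> (\<forall>k\<in>set F. k \<noteq> j \<longrightarrow> k \<in> set G))"
    by simp
  then show ?thesis
  proof
    assume "\<exists>i\<in>set [0..<4]. 0 < node_coords ! j ! i \<and> (\<forall>k\<in>set F. k \<noteq> j \<longrightarrow> node_coords ! k ! i = 0)"
    then obtain i where "i \<in> set [0..<4]" "0 < node_coords ! j ! i" "\<forall>k\<in>set F. k \<noteq> j \<longrightarrow> node_coords ! k ! i = 0"
      by blast
    moreover from this(1) have "i < 4"
      by simp
    ultimately show ?thesis
      by blast
  next
    assume "\<exists>(G, e)\<in>set cells. j \<notin> set G \<and> (\<forall>k\<in>set F. k \<noteq> j \<longrightarrow> k \<in> set G)"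
    then show ?thesis
      by (intro disjI2) blast
  qed
qed

text \<open>A node may be labelled by the columns of its positive barycentric coordinates.
  \<open>product_lists\<close> enumerates all such choices, and each is tested. As cells have four
  distinct nodes, the condition on \<open>F\<close> excludes just the cell
  \<open>[5, 6, 7, 8]\<close>.\<close>

lemma distinct_labels_elsewhere:
  assumes L: "\<And>j. j < 9 \<Longrightarrow> L j < 4 \<and> 0 < node_coords ! j ! L j"
  obtains F c where "(F, c) \<in> set cells" "\<not> set F \<subseteq> {5..<9}" "inj_on L (set F)"
proof -
  have *: "\<forall>ls\<in>set (product_lists (map (\<lambda>j. filter (\<lambda>i. 0 < node_coords ! j ! i) [0..<4]) [0..<9])).
      \<exists>(F, c)\<in>set cells. (\<exists>j\<in>set F. j < 5) \<and> distinct (map ((!) ls) F)"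
    by (simp add: table_simps)
  have "map L [0..<9] \<in> set (product_lists (map (\<lambda>j. filter (\<lambda>i. 0 < node_coords ! j ! i) [0..<4]) [0..<9]))"
    using L by (auto simp: product_lists_set list_all2_conv_all_nth)
  from bspec[OF * this] obtain F c where F: "(F, c) \<in> set cells" "\<exists>j\<in>set F. j < 5"
    "distinct (map ((!) (map L [0..<9])) F)"
    by blast
  have eq: "map ((!) (map L [0..<9])) F = map L F"
    using cell_indices(3)[OF F(1)] by auto
  have "inj_on L (set F)"
    using F(3) unfolding eq by (simp add: distinct_map)
  then show ?thesis
    using that F by fastforce
qed

section \<open>The join of the example with the remaining vertices\<close>

locale sperner_frame =
  fixes d :: nat and v :: "nat \<Rightarrow> 'a::euclidean_space"
  assumes d: "3 \<le> d" and inj_v: "inj_on v {1..d + 1}" and indep_v: "\<not> affine_dependent (v ` {1..d + 1})"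
begin

text \<open>Table columns are numbered from 0 and the vertices from 1; the division by 7 undoes the
  scaling of the table.\<close>

definition node :: "nat \<Rightarrow> 'a" where
  "node j = (\<Sum>i<4. (node_coords ! j ! i / 7) *\<^sub>R v (i + 1))"

text \<open>The vertex set of a join of simplices; for \<open>d = 3\<close> the second set is
  empty.\<close>

definition cell :: "nat list \<Rightarrow> 'a set" where
  "cell F = node ` set F \<union> v ` {5..d + 1}"

text \<open>Barycentric coordinates, extended from the affine hull of the simplex to the whole
  space; the extension need not be unique.\<close>

definition bary :: "nat \<Rightarrow> 'a \<Rightarrow> real" where
  "bary i = (SOME f. affine_fun f \<and> (\<forall>k\<in>{1..d + 1}. f (v k) = (if k = i then 1 else 0)))"

lemma affine_bary: "affine_fun (bary i)"
  and bary_v: "k \<in> {1..d + 1} \<Longrightarrow> bary i (v k) = (if k = i then 1 else 0)"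
proof -
  \<comment> \<open>\<open>affine_fun_extend\<close> prescribes values by point, so the index of a
    vertex is recovered by inverting \<open>v\<close>.\<close>
  obtain f where f: "affine_fun f" "\<And>x. x \<in> v ` {1..d + 1} \<Longrightarrow>
      f x = (if the_inv_into {1..d + 1} v x = i then 1 else 0)"
    by (rule affine_fun_extend[OF indep_v, of "\<lambda>x. if the_inv_into {1..d + 1} v x = i then 1 else 0"])
      blast
  then have "\<exists>f. affine_fun f \<and> (\<forall>k\<in>{1..d + 1}. f (v k) = (if k = i then 1 else 0))"
    using inj_v by (intro exI[of _ f]) (simp add: the_inv_into_f_f)
  from someI_ex[OF this] show "affine_fun (bary i)"
    "k \<in> {1..d + 1} \<Longrightarrow> bary i (v k) = (if k = i then 1 else 0)"
    unfolding bary_def by blast+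
qed

lemma sum_weights: "j < 9 \<Longrightarrow> (\<Sum>i<4. real (node_coords ! j ! i) / 7) = 1"
  using sum_node_coords[of j] by (simp flip: sum_divide_distrib of_nat_sum)

lemma affine_fun_node:
  assumes "affine_fun f" "j < 9"
  shows "f (node j) = (\<Sum>i<4. real (node_coords ! j ! i) * f (v (i + 1))) / 7"
  unfolding node_def using affine_fun_combination[OF assms(1) sum_weights[OF assms(2)]]
  by (simp add: sum_divide_distrib)

lemma bary_node:
  assumes "j < 9" "i < 4"
  shows "bary (i + 1) (node j) = node_coords ! j ! i / 7"
proof -
  have "(\<Sum>k<4. real (node_coords ! j ! k) * bary (i + 1) (v (k + 1))) =
    (\<Sum>k<4. if k = i then real (node_coords ! j ! k) else 0)"
    using d by (intro sum.cong) (auto simp: bary_v)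
  then show ?thesis
    using assms by (simp add: affine_fun_node[OF affine_bary])
qed

lemma bary_node_0:
  assumes "j < 9" "5 \<le> i"
  shows "bary i (node j) = 0"
proof -
  have "(\<Sum>k<4. real (node_coords ! j ! k) * bary i (v (k + 1))) = 0"
    using d assms by (intro sum.neutral) (auto simp: bary_v)
  then show ?thesis
    using assms by (simp add: affine_fun_node[OF affine_bary])
qed

lemma node_vertex:
  assumes "i < 4"
  shows "node i = v (i + 1)"
proof -
  have "node i = (\<Sum>k<4. if k = i then v (k + 1) else 0)"
    unfolding node_def using assms by (intro sum.cong) (auto simp: node_coords_vertex)
  then show ?thesis
    using assms by simp
qed

lemma inj_node: "inj_on node {..<9}"
proof (rule inj_onI)
  fix j k assume jk: "j \<in> {..<9}" "k \<in> {..<9}" "node j = node k"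
  have "node_coords ! j ! i = node_coords ! k ! i" if "i < 4" for i
    using bary_node[of j i] bary_node[of k i] jk that by simp
  then show "j = k"
    using jk node_coords_inj by simp
qed

lemma node_neq_v:
  assumes "j < 9" "i \<in> {5..d + 1}"
  shows "node j \<noteq> v i"
  using bary_node_0[of j i] bary_v[of i i] assms by auto

lemma node_in_cell_iff:
  assumes "j < 9" "set F \<subseteq> {..<9}"
  shows "node j \<in> cell F \<longleftrightarrow> j \<in> set F"
proof -
  have "node j \<notin> v ` {5..d + 1}"
    using node_neq_v[OF assms(1)] by blast
  then show ?thesis
    using assms inj_node by (simp add: cell_def inj_on_image_mem_iff)
qed

text \<open>The support of row \<open>j\<close> spans the face to which the Sperner condition for
  \<open>node j\<close> is applied later.\<close>

lemma node_in_convex_hull: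
  assumes "j < 9"
  shows "node j \<in> convex hull ((\<lambda>i. v (i + 1)) ` {i. i < 4 \<and> 0 < node_coords ! j ! i})"
proof -
  define I where "I = {i. i < 4 \<and> 0 < node_coords ! j ! i}"
  have I: "finite I" "I \<subseteq> {..<4}"
    by (auto simp: I_def)
  have "(\<Sum>i\<in>I. real (node_coords ! j ! i) / 7) = 1"
    unfolding sum_weights[OF assms, symmetric]
    by (rule sum.mono_neutral_left) (auto simp: I_def)
  moreover have "node j = (\<Sum>i\<in>I. (node_coords ! j ! i / 7) *\<^sub>R v (i + 1))"
    unfolding node_def by (rule sum.mono_neutral_right) (auto simp: I_def)
  ultimately show ?thesis
    unfolding I_def[symmetric] using I(1)
    by (auto intro!: convex_sum simp: hull_inc)
qed

lemma cell_subset: "set F \<subseteq> {..<9} \<Longrightarrow> cell F \<subseteq> convex hull (v ` {1..d + 1})"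
proof -
  assume F: "set F \<subseteq> {..<9}"
  have "node j \<in> convex hull (v ` {1..d + 1})" if "j \<in> set F" for j
  proof -
    have "(\<lambda>i. v (i + 1)) ` {i. i < 4 \<and> 0 < node_coords ! j ! i} \<subseteq> v ` {1..d + 1}"
      using d by auto
    then show ?thesis
      using node_in_convex_hull[of j] hull_mono F that by blast
  qed
  then show ?thesis
    by (auto simp: cell_def intro: hull_inc)
qed

text \<open>Only the first four barycentric coordinates enter, so the functional vanishes at
  \<open>v 5, ..., v (d + 1)\<close> and the tabulated heights extend by 0 to the join.\<close>

definition functional :: "nat list \<Rightarrow> 'a \<Rightarrow> real" where
  "functional c x = (\<Sum>i<4. real (c ! i) * bary (i + 1) x)"

lemma affine_functional: "affine_fun (functional c)"
  unfolding functional_def by (intro affine_fun_sum affine_fun_scale affine_bary)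

lemma functional_node:
  assumes "j < 9"
  shows "functional c (node j) = functional_value c j / 7"
proof -
  have "functional c (node j) = (\<Sum>i<4. real (c ! i) * (real (node_coords ! j ! i) / 7))"
    unfolding functional_def using assms by (intro sum.cong) (auto simp: bary_node[simplified])
  then show ?thesis
    by (simp add: functional_value_def interv_sum_list_conv_sum_set_nat atLeast0LessThan sum_divide_distrib)
qed

lemma functional_v: "i \<in> {5..d + 1} \<Longrightarrow> functional c (v i) = 0"
  by (simp add: functional_def bary_v)

text \<open>The lower envelope of the functionals yields a height at every point without inverting
  \<open>node\<close>.\<close>

definition height :: "'a \<Rightarrow> real" where
  "height x = Min ((\<lambda>(F, c). functional c x) ` set cells)"

text \<open>The minimum is attained at any cell containing node \<open>j\<close>, since the
  functionals of all other cells are larger there.\<close>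

lemma height_node:
  assumes "j < 9"
  shows "height (node j) = node_heights ! j / 7"
  unfolding height_def
proof (rule Min_eqI)
  obtain F c where F: "(F, c) \<in> set cells" "j \<in> set F"
    using node_in_cell[OF assms] .
  then have "node_heights ! j / 7 = functional c (node j)"
    by (simp add: functional_node[OF assms] functional_value_eq)
  then show "node_heights ! j / 7 \<in> (\<lambda>(F, c). functional c (node j)) ` set cells"
    using F(1) by force
  fix y assume "y \<in> (\<lambda>(F, c). functional c (node j)) ` set cells"
  then obtain F c where F: "(F, c) \<in> set cells" "y = functional c (node j)"
    by auto
  have "node_heights ! j \<le> functional_value c j"
    using functional_value_eq[OF F(1)] functional_value_gt[OF F(1) assms] by (cases "j \<in> set F") auto
  then show "node_heights ! j / 7 \<le> y"
    by (simp add: F(2) functional_node[OF assms] divide_right_mono)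
qed simp

lemma height_v:
  assumes "i \<in> {5..d + 1}"
  shows "height (v i) = 0"
  unfolding height_def
proof (rule Min_eqI)
  obtain F c where "(F, c) \<in> set cells"
    by (rule node_in_cell[of 0]) auto
  then show "0 \<in> (\<lambda>(F, c). functional c (v i)) ` set cells"
    using functional_v[OF assms] by force
qed (use functional_v[OF assms] in auto)

definition facets :: "'a set set" where
  "facets = cell ` fst ` set cells"

lemma facetE:
  assumes "S \<in> facets"
  obtains F c where "(F, c) \<in> set cells" "S = cell F"
  using assms by (auto simp: facets_def)

lemma facetI: "(F, c) \<in> set cells \<Longrightarrow> cell F \<in> facets"
  by (force simp: facets_def)

lemma Union_facets: "\<Union>facets = node ` {..<9} \<union> v ` {5..d + 1}"
proof
  show "\<Union>facets \<subseteq> node ` {..<9} \<union> v ` {5..d + 1}"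
    using cell_indices(3) by (fastforce simp: cell_def elim!: facetE)
  obtain F c where F: "(F, c) \<in> set cells"
    by (rule node_in_cell[of 0]) auto
  have "v ` {5..d + 1} \<subseteq> \<Union>facets"
    using facetI[OF F] unfolding cell_def by blast
  moreover have "node j \<in> \<Union>facets" if j: "j < 9" for j
  proof -
    obtain F c where F: "(F, c) \<in> set cells" "j \<in> set F"
      by (rule node_in_cell[OF j])
    then show ?thesis
      using facetI[OF F(1)] unfolding cell_def by blast
  qed
  ultimately show "node ` {..<9} \<union> v ` {5..d + 1} \<subseteq> \<Union>facets"
    by auto
qed

text \<open>Four nodes and \<open>d - 3\<close> added vertices, with no coincidences.\<close>

lemma card_cell:
  assumes "(F, c) \<in> set cells"
  shows "card (cell F) = card (v ` {1..d + 1})"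
proof -
  note F = cell_indices[OF assms]
  have "card (node ` set F) = 4"
    using F inj_on_subset[OF inj_node F(3)] by (simp add: card_image distinct_card)
  moreover have "card (v ` {5..d + 1}) = d - 3"
    using inj_on_subset[OF inj_v, of "{5..d + 1}"] by (simp add: card_image)
  moreover have "node ` set F \<inter> v ` {5..d + 1} = {}"
    using F(3) node_neq_v by blast
  ultimately show ?thesis
    using d inj_v by (simp add: cell_def card_Un_disjoint card_image)
qed

text \<open>A wall opposite a node is handled as in the table, joined with the remaining vertices. A
  wall opposite \<open>v i\<close> with \<open>i \<ge> 5\<close> is on the boundary, as every other
  point of the cell has \<open>i\<close>-th barycentric coordinate 0.\<close>

lemma regular_facets: "regular_facets (v ` {1..d + 1}) height facets"
  unfolding regular_facets_def
proof (intro conjI ballI)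
  show "finite facets" "facets \<noteq> {}"
    by (auto simp: facets_def cells_def)
  show "v ` {1..d + 1} \<subseteq> \<Union>facets"
  proof
    fix x assume "x \<in> v ` {1..d + 1}"
    then obtain i where i: "x = v i" "i \<in> {1..d + 1}"
      by blast
    show "x \<in> \<Union>facets"
    proof (cases "5 \<le> i")
      case False
      then have "x = node (i - 1)" "i - 1 < 9"
        using i node_vertex[of "i - 1"] by auto
      then show ?thesis
        unfolding Union_facets by blast
    qed (use i Union_facets in auto)
  qed
  show "\<Union>facets \<subseteq> convex hull (v ` {1..d + 1})"
    using cell_subset cell_indices(3) by (blast elim: facetE)
  fix S assume "S \<in> facets"
  then obtain F c where F: "(F, c) \<in> set cells" and S: "S = cell F"
    by (rule facetE)
  note F_sub = cell_indices(3)[OF F]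
  show "card S = card (v ` {1..d + 1})"
    using card_cell[OF F] S by simp
  show "\<exists>g. affine_fun g \<and> (\<forall>p\<in>S. g p = height p) \<and> (\<forall>p\<in>\<Union>facets - S. height p < g p)"
  proof (intro exI conjI ballI)
    show "affine_fun (functional c)"
      by (rule affine_functional)
    show "functional c p = height p" if "p \<in> S" for p
      using that F_sub functional_value_eq[OF F] unfolding S cell_def
      by (auto simp: functional_node height_node functional_v height_v subset_eq)
    show "height p < functional c p" if p: "p \<in> \<Union>facets - S" for p
    proof -
      \<comment> \<open>Every cell contains all added vertices, so a point outside \<open>S\<close>
        is a node.\<close>
      have "p \<notin> v ` {5..d + 1}"
        using p by (auto simp: S cell_def)
      then obtain j where j: "j < 9" "p = node j"
        using p unfolding Union_facets by blast
      then have "j \<notin> set F"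
        using p by (auto simp: S cell_def)
      then show ?thesis
        using functional_value_gt[OF F j(1)] j by (simp add: functional_node height_node divide_strict_right_mono)
    qed
  qed
  fix s assume "s \<in> S"
  then consider (node) j where "j \<in> set F" "s = node j" | (vertex) i where "i \<in> {5..d + 1}" "s = v i"
    unfolding S cell_def by blast
  then show "(\<exists>b. affine_fun b \<and> (\<forall>x\<in>v ` {1..d + 1}. 0 \<le> b x) \<and> 0 < b s \<and> (\<forall>p\<in>S - {s}. b p = 0)) \<or>
      (\<exists>T\<in>facets. T \<noteq> S \<and> S - {s} \<subseteq> T)"
  proof cases
    case node
    then have j: "j < 9"
      using F_sub by auto
    from cell_walls[OF F node(1)] show ?thesis
    proof
      assume "\<exists>i<4. 0 < node_coords ! j ! i \<and> (\<forall>k\<in>set F - {j}. node_coords ! k ! i = 0)"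
      then obtain i where i: "i < 4" "0 < node_coords ! j ! i" "\<And>k. k \<in> set F - {j} \<Longrightarrow> node_coords ! k ! i = 0"
        by blast
      have "bary (i + 1) p = 0" if p: "p \<in> S - {s}" for p
      proof (cases "p \<in> v ` {5..d + 1}")
        case False
        then obtain k where "k \<in> set F - {j}" "p = node k"
          using p node(2) unfolding S cell_def by blast
        then show ?thesis
          using bary_node[of k i] i F_sub by auto
      qed (use i(1) in \<open>auto simp: bary_v\<close>)
      moreover have "0 < bary (i + 1) s"
        using bary_node[OF j i(1)] i(2) node(2) by simp
      moreover have "\<forall>x\<in>v ` {1..d + 1}. 0 \<le> bary (i + 1) x"
        by (simp add: bary_v)
      ultimately show ?thesis
        using affine_bary by blast
    next
      assume "\<exists>(G, e)\<in>set cells. j \<notin> set G \<and> set F - {j} \<subseteq> set G"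
      then obtain G e where G: "(G, e) \<in> set cells" "j \<notin> set G" "set F - {j} \<subseteq> set G"
        by blast
      have "s \<notin> cell G" "s \<in> S"
        using node_in_cell_iff[OF j cell_indices(3)[OF G(1)]] G(2) node \<open>s \<in> S\<close> by auto
      moreover have "S - {s} \<subseteq> cell G"
        using G(3) node(2) unfolding S cell_def by blast
      ultimately show ?thesis
        using facetI[OF G(1)] by blast
    qed
  next
    case vertex
    have "bary i p = 0" if p: "p \<in> S - {s}" for p
    proof (cases "p \<in> v ` {5..d + 1}")
      case True
      then show ?thesis
        using p vertex by (auto simp: bary_v)
    next
      case False
      then obtain k where "k \<in> set F" "p = node k"
        using p unfolding S cell_def by blast
      then show ?thesis
        using bary_node_0[of k i] vertex(1) F_sub by auto
    qed
    moreover have "0 < bary i s"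
      using vertex by (simp add: bary_v)
    moreover have "\<forall>x\<in>v ` {1..d + 1}. 0 \<le> bary i x"
      by (simp add: bary_v)
    ultimately show ?thesis
      using affine_bary by blast
  qed
qed

lemma central_cell: "\<exists>c. ([5, 6, 7, 8], c) \<in> set cells"
  by (auto simp: cells_def)

text \<open>A Sperner map sends nodes to \<open>v 1, ..., v 4\<close> and fixes each added vertex,
  so a cell of the table with distinct labels stays rainbow after the join.\<close>

lemma rainbow_elsewhere: "rainbow_elsewhere (v ` {1..d + 1}) facets (cell [5, 6, 7, 8])"
  unfolding rainbow_elsewhere_def
proof (intro conjI allI impI)
  show "cell [5, 6, 7, 8] \<in> facets"
    using central_cell facetI by blast
  have ne: "cell F \<noteq> cell [5, 6, 7, 8]" if F: "(F, c) \<in> set cells" "\<not> set F \<subseteq> {5..<9}" for F c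
  proof -
    obtain j where j: "j \<in> set F" "j \<notin> {5..<9}"
      using F(2) by blast
    then have "j < 9"
      using cell_indices(3)[OF F(1)] by auto
    then have "node j \<in> cell F" "node j \<notin> cell [5, 6, 7, 8]"
      using j node_in_cell_iff[of j "[5, 6, 7, 8]"] by (auto simp: cell_def)
    then show ?thesis
      by blast
  qed
  \<comment> \<open>Node 0 is outside the central cell, so any cell containing it is a second
    facet.\<close>
  obtain F c where F: "(F, c) \<in> set cells" "0 \<in> set F"
    by (rule node_in_cell[of 0]) auto
  then have "\<not> set F \<subseteq> {5..<9}"
    by force
  then have "cell F \<in> facets" "cell F \<noteq> cell [5, 6, 7, 8]"
    using ne facetI F(1) by auto
  then show "facets \<noteq> {cell [5, 6, 7, 8]}"
    by blast
  fix m assume m: "sperner_map (v ` {1..d + 1}) facets m"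
  have "\<exists>l. l < 4 \<and> 0 < node_coords ! j ! l \<and> m (node j) = v (l + 1)" if j: "j < 9" for j
  proof -
    have "node j \<in> \<Union>facets"
      using j by (simp add: Union_facets)
    moreover have "(\<lambda>i. v (i + 1)) ` {i. i < 4 \<and> 0 < node_coords ! j ! i} \<subseteq> v ` {1..d + 1}"
      using d by auto
    ultimately have "m (node j) \<in> (\<lambda>i. v (i + 1)) ` {i. i < 4 \<and> 0 < node_coords ! j ! i}"
      using m node_in_convex_hull[OF j] unfolding sperner_map_def by blast
    then show ?thesis
      by auto
  qed
  \<comment> \<open>\<open>L j\<close> is the column whose vertex carries the label of node
    \<open>j\<close>.\<close>
  then obtain L where L: "\<And>j. j < 9 \<Longrightarrow> L j < 4 \<and> 0 < node_coords ! j ! L j"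
    "\<And>j. j < 9 \<Longrightarrow> m (node j) = v (L j + 1)"
    by metis
  obtain F c where F: "(F, c) \<in> set cells" "\<not> set F \<subseteq> {5..<9}" "inj_on L (set F)"
    using distinct_labels_elsewhere[OF L(1)] by blast
  note F_sub = cell_indices(3)[OF F(1)]
  \<comment> \<open>The Sperner condition for the zero-dimensional face \<open>{v i}\<close> leaves
    only one label.\<close>
  have m_v: "m (v i) = v i" if i: "i \<in> {5..d + 1}" for i
  proof -
    have "v i \<in> \<Union>facets"
      using i by (simp add: Union_facets)
    moreover have "{v i} \<subseteq> v ` {1..d + 1}"
      using i by auto
    ultimately have "m (v i) \<in> {v i}"
      using m unfolding sperner_map_def by (metis convex_hull_singleton singletonI)
    then show ?thesis
      by simp
  qed
  have v_eq: "i = k" if "v i = v k" "i \<in> {1..d + 1}" "k \<in> {1..d + 1}" for i k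
    using inj_v that by (meson inj_onD)
  have "inj_on m (cell F)"
    unfolding cell_def
  proof (rule inj_on_Un[THEN iffD2], intro conjI)
    show "inj_on m (node ` set F)"
    proof (rule inj_onI)
      fix x y assume "x \<in> node ` set F" "y \<in> node ` set F" and eq: "m x = m y"
      then obtain j k where jk: "j \<in> set F" "k \<in> set F" "x = node j" "y = node k"
        by blast
      then have "j < 9" "k < 9"
        using F_sub by auto
      then have "L j + 1 = L k + 1"
        using eq jk L[of j] L[of k] d by (intro v_eq) auto
      then have "j = k"
        using inj_onD[OF F(3) _ jk(1,2)] by simp
      then show "x = y"
        using jk by simp
    qed
    show "inj_on m (v ` {5..d + 1})"
      by (rule inj_onI) (auto simp: m_v)
    have "m (node j) \<noteq> v i" if "j \<in> set F" "i \<in> {5..d + 1}" for i j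
    proof
      assume eq: "m (node j) = v i"
      have "j < 9"
        using that F_sub by auto
      then have "L j + 1 = i"
        using eq that L[of j] d by (intro v_eq) auto
      then show False
        using that L(1)[OF \<open>j < 9\<close>] by auto
    qed
    then show "m ` (node ` set F - v ` {5..d + 1}) \<inter> m ` (v ` {5..d + 1} - node ` set F) = {}"
      by (auto simp: m_v)
  qed
  then show "\<exists>\<tau>\<in>facets. \<tau> \<noteq> cell [5, 6, 7, 8] \<and> inj_on m \<tau>"
    using ne[OF F(1,2)] facetI[OF F(1)] by blast
qed

end

theorem theorem1p4:
  fixes d :: nat and v :: "nat \<Rightarrow> 'a::euclidean_space"
  assumes "d \<ge> 3"
    and "inj_on v {1..d + 1}" and "\<not> affine_dependent (v ` {1..d + 1})"
  shows "\<exists>\<K>. infinite \<K> \<and>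
    pairwise (\<lambda>K L. \<not> combinatorially_isomorphic K L) \<K> \<and>
    (\<forall>K\<in>\<K>. simplex_triangulation d v K \<and>
       (\<exists>\<sigma>\<in>complex_facets d K.
          \<forall>l. sperner_labelling d v K l \<longrightarrow>
            (\<exists>\<tau>\<in>complex_facets d K. \<tau> \<noteq> \<sigma> \<and> rainbow l \<tau>)))"
proof -
  interpret sperner_frame d v
    using assms by unfold_locales
  have "1 \<le> d"
    using assms(1) by simp
  from triangulations_from_one[OF this assms(2,3) regular_facets rainbow_elsewhere] show ?thesis .
qed

end
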